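(* For all natural numbers $n, t$ and every $\epsilon > 0$, there exist $k$ and $d$ and a private code $\mathrm{Enc}\colon \{0,1\}^k \times \{0,1\}^d \to \{0,1\}^n$, computable in polynomial time, that is $(t,\epsilon)$-resilient in the Hamming scenario and such that \begin{itemize} \item $k \ge n - t - \lceil \log \tfrac{1}{\epsilon} \rceil$, \item the encoder $\mathrm{Enc}$ and the decoder functions $\mathrm{Dec}$ share $d = 2n$ random bits. \end{itemize}
   Context: Logarithms are base 2. A private code is a function $\mathrm{Enc}\colon \mathcal{M}\times\mathcal{R}\to\mathcal{X}$ ($\mathcal{M}$ = messages, $\mathcal{R}$ = shared random strings, $\mathcal{X}$ = codewords); write $\mathrm{Enc}_\rho(m)=\mathrm{Enc}(m,\rho)$. When $\mathcal{R}=\{0,1\}^d$ one says that the encoder and the decoders share $d$ random bits. A decoding function is a map $\mathrm{Dec}\colon \widetilde{\mathcal{X}}\times\mathcal{R}\to\mathcal{M}$, with $\mathrm{Dec}_\rho(\tilde x)=\mathrm{Dec}(\tilde x,\rho)$; it receives the same $\rho$ as the encoder. Polynomial time means time polynomial in $n$. A Hamming channel from $\mathcal{X}$ to $\widetilde{\mathcal{X}}$ is a bipartite graph with left set $\mathcal{X}$ and right set $\widetilde{\mathcal{X}}$ in which every left node has degree at least 1. Its distortion is the maximal degree of a right node. A channel function of the channel is a map $\mathrm{Ch}\colon\mathcal{X}\to\widetilde{\mathcal{X}}$ such that $(x,\mathrm{Ch}(x))$ is an edge for every $x\in\mathcal{X}$. $\mathrm{Enc}\colon \mathcal{M}\times\mathcal{R}\to\mathcal{X}$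 is $(t,\epsilon)$-resilient in the Hamming scenario if for every $\widetilde{\mathcal{X}}$ and every Hamming channel from $\mathcal{X}$ to $\widetilde{\mathcal{X}}$ with distortion at most $2^t$, there exists a decoding function $\mathrm{Dec}\colon\widetilde{\mathcal{X}}\times\mathcal{R}\to\mathcal{M}$ such that for all channel functions $\mathrm{Ch}$ of this channel and all $m\in\mathcal{M}$, $$\Pr_{\rho\in\mathcal{R}}[\mathrm{Dec}_\rho(\mathrm{Ch}(\mathrm{Enc}_\rho(m)))=m]\ge 1-\epsilon,$$ where $\rho$ is uniform in $\mathcal{R}$. *)

theory Defs
  imports "HOL-Probability.Probability" "HOL-Computational_Algebra.Polynomial"
begin

section \<open>Private codes in the Hamming scenario\<close>

definition bitstrings :: "nat \<Rightarrow> bool list set" where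
  "bitstrings n = {w. length w = n}"

text \<open>A channel is a bipartite graph with left set \<open>X\<close>, right set \<open>Y\<close> and edge set \<open>E\<close>.\<close>

definition hamming_channel :: "'x set \<Rightarrow> 'y set \<Rightarrow> ('x \<times> 'y) set \<Rightarrow> bool" where
  "hamming_channel X Y E \<longleftrightarrow> E \<subseteq> X \<times> Y \<and> (\<forall>x\<in>X. \<exists>y\<in>Y. (x, y) \<in> E)"

text \<open>
  The maximum is attained whenever \<open>X\<close> is finite and \<open>Y\<close> is nonempty: right degrees are then at
  most \<open>card X\<close>, so the set of degrees is finite even if \<open>Y\<close> is not.
\<close>

definition distortion :: "'y set \<Rightarrow> ('x \<times> 'y) set \<Rightarrow> nat" where
  "distortion Y E = Max ((\<lambda>y. card {x. (x, y) \<in> E}) ` Y)"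

definition channel_function :: "'x set \<Rightarrow> ('x \<times> 'y) set \<Rightarrow> ('x \<Rightarrow> 'y) \<Rightarrow> bool" where
  "channel_function X E Ch \<longleftrightarrow> (\<forall>x\<in>X. (x, Ch x) \<in> E)"

definition decodable ::
  "real \<Rightarrow> 'm set \<Rightarrow> 'r set \<Rightarrow> 'x set \<Rightarrow> ('m \<times> 'r \<Rightarrow> 'x) \<Rightarrow> 'y set \<Rightarrow> ('x \<times> 'y) set \<Rightarrow> bool" where
  "decodable \<epsilon> M R X Enc Y E \<longleftrightarrow>
     (\<exists>Dec \<in> Y \<times> R \<rightarrow> M. \<forall>Ch. channel_function X E Ch \<longrightarrow>
        (\<forall>m\<in>M. measure_pmf.prob (pmf_of_set R) {\<rho>. Dec (Ch (Enc (m, \<rho>)), \<rho>) = m} \<ge> 1 - \<epsilon>))"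

text \<open>
  HOL cannot quantify over types inside a definition, so the right sets of the channels are taken
  to be sets of natural numbers. For finite \<open>X\<close> this is no restriction: the lemma
  \<open>hamming_resilient_any_type\<close> below extends the property to right sets in an arbitrary type.
\<close>

definition hamming_resilient ::
  "nat \<Rightarrow> real \<Rightarrow> 'm set \<Rightarrow> 'r set \<Rightarrow> 'x set \<Rightarrow> ('m \<times> 'r \<Rightarrow> 'x) \<Rightarrow> bool" where
  "hamming_resilient t \<epsilon> M R X Enc \<longleftrightarrow>
     (\<forall>(Y :: nat set) E. hamming_channel X Y E \<and> distortion Y E \<le> 2 ^ t \<longrightarrow>
        decodable \<epsilon> M R X Enc Y E)"

lemma hamming_resilient_any_type:
  fixes Y :: "'y set"
  assumes res: "hamming_resilient t \<epsilon> M R X Enc" and fin: "finite X"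
    and ch: "hamming_channel X Y E" and dist: "distortion Y E \<le> 2 ^ t"
  shows "decodable \<epsilon> M R X Enc Y E"
proof -
  define N where "N y = {x. (x, y) \<in> E}" for y
  have "finite (Pow X)" using fin by simp
  then obtain c :: "_ \<Rightarrow> nat" where c: "inj_on c (Pow X)"
    using finite_imp_inj_to_nat_seg by metis
  have NX: "N y \<in> Pow X" for y using ch by (auto simp: N_def hamming_channel_def)
  have cN: "c (N y) = c (N z) \<longleftrightarrow> N y = N z" for y z
    using inj_on_eq_iff[OF c NX NX] .
  define f where "f y = c (N y)" for y
  define E' where "E' = {(x, f y) | x y. (x, y) \<in> E}"
  have nb: "{x. (x, f y) \<in> E'} = N y" if "y \<in> Y" for y
    using cN by (fastforce simp: E'_def f_def N_def)
  have "hamming_channel X (f ` Y) E'"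
    using ch by (fastforce simp: hamming_channel_def E'_def)
  moreover have "distortion (f ` Y) E' = distortion Y E"
    unfolding distortion_def image_image using nb by (simp add: N_def)
  ultimately have "decodable \<epsilon> M R X Enc (f ` Y) E'"
    using res dist by (simp add: hamming_resilient_def)
  then obtain Dec where D: "Dec \<in> f ` Y \<times> R \<rightarrow> M"
    and P: "\<And>Ch m. channel_function X E' Ch \<Longrightarrow> m \<in> M \<Longrightarrow>
      measure_pmf.prob (pmf_of_set R) {\<rho>. Dec (Ch (Enc (m, \<rho>)), \<rho>) = m} \<ge> 1 - \<epsilon>"
    unfolding decodable_def by blast
  show ?thesis unfolding decodable_def
  proof (intro bexI allI impI ballI)
    show "(\<lambda>(y, \<rho>). Dec (f y, \<rho>)) \<in> Y \<times> R \<rightarrow> M" using D by auto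
  next
    fix Ch m assume C: "channel_function X E Ch" and m: "m \<in> M"
    have "channel_function X E' (f \<circ> Ch)"
      using C by (auto simp: channel_function_def E'_def)
    from P[OF this m]
    show "measure_pmf.prob (pmf_of_set R)
        {\<rho>. (case (Ch (Enc (m, \<rho>)), \<rho>) of (y, \<rho>) \<Rightarrow> Dec (f y, \<rho>)) = m} \<ge> 1 - \<epsilon>"
      by simp
  qed
qed

section \<open>Deterministic multi-tape Turing machines\<close>

text \<open>
  States and tape symbols are natural numbers below the bounds stored in the machine; state 0 is
  initial, symbol 0 is the blank, and symbols 1 and 2 stand for the bits 0 and 1. A transition
  reads the symbols under all heads and yields the next state and, for every tape, a symbol to
  write and a head move; \<open>None\<close> means that the machine halts. Tapes are infinite in both
  directions, and a tape is stored as its head position together with its contents.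
\<close>

datatype head_move = Move_Left | Stay | Move_Right

record turing_machine =
  num_tapes :: nat
  num_symbols :: nat
  num_states :: nat
  transition :: "nat \<Rightarrow> nat list \<Rightarrow> (nat \<times> (nat \<times> head_move) list) option"

definition wf_turing_machine :: "turing_machine \<Rightarrow> bool" where
  "wf_turing_machine T \<longleftrightarrow> num_symbols T \<ge> 3 \<and> num_states T \<ge> 1 \<and>
     (\<forall>q syms q' acts. q < num_states T \<and> length syms = num_tapes T \<and>
        set syms \<subseteq> {..<num_symbols T} \<and> transition T q syms = Some (q', acts) \<longrightarrow>
        q' < num_states T \<and> length acts = num_tapes T \<and> fst ` set acts \<subseteq> {..<num_symbols T})"

type_synonym tape = "int \<times> (int \<Rightarrow> nat)"
type_synonym config = "nat \<times> tape list"

fun read_tape :: "tape \<Rightarrow> nat" where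
  "read_tape (h, f) = f h"

fun move_head :: "head_move \<Rightarrow> int \<Rightarrow> int" where
  "move_head Move_Left h = h - 1"
| "move_head Stay h = h"
| "move_head Move_Right h = h + 1"

fun act_tape :: "nat \<times> head_move \<Rightarrow> tape \<Rightarrow> tape" where
  "act_tape (s, mv) (h, f) = (move_head mv h, f(h := s))"

fun tm_halted :: "turing_machine \<Rightarrow> config \<Rightarrow> bool" where
  "tm_halted T (q, ts) \<longleftrightarrow> transition T q (map read_tape ts) = None"

fun tm_step :: "turing_machine \<Rightarrow> config \<Rightarrow> config" where
  "tm_step T (q, ts) =
     (case transition T q (map read_tape ts) of
        None \<Rightarrow> (q, ts)
      | Some (q', acts) \<Rightarrow> (q', map2 act_tape acts ts))"

definition tape_contents :: "bool list \<Rightarrow> int \<Rightarrow> nat" where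
  "tape_contents w i =
     (if 0 \<le> i \<and> i < int (length w) then (if w ! nat i then 2 else 1) else 0)"

text \<open>
  The arguments are written on the first tapes, one argument per tape, and all other tapes are
  blank. The result is left on the first tape after the argument tapes, which must be blank
  outside the result.
\<close>

definition tm_init :: "turing_machine \<Rightarrow> bool list list \<Rightarrow> config" where
  "tm_init T ws =
     (0, map (\<lambda>i. (0, tape_contents (if i < length ws then ws ! i else []))) [0..<num_tapes T])"

definition tm_computes_within ::
  "turing_machine \<Rightarrow> nat \<Rightarrow> bool list list \<Rightarrow> bool list \<Rightarrow> bool" where
  "tm_computes_within T b ws w \<longleftrightarrow> length ws < num_tapes T \<and>
     (\<exists>s\<le>b. let c = (tm_step T ^^ s) (tm_init T ws) in
        tm_halted T c \<and> snd (snd c ! length ws) = tape_contents w)"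

end

theory Submission imports Defs begin

text \<open>
  Split \<open>\<rho>\<close> into \<open>a, b \<in> {0,1}\<^sup>n\<close> and encode \<open>m\<close> as \<open>(T\<^sub>a m, m) + b\<close> over the two-element field,
  where \<open>T\<^sub>a\<close> is the \<open>(n - k) \<times> k\<close> Toeplitz matrix with entries from \<open>a\<close> (\<open>n - 1\<close> bits suffice). For
  fixed \<open>m\<close> the codeword \<open>x\<close> is uniform, and every \<open>v \<noteq> 0\<close> is of the form \<open>(T\<^sub>a \<delta>, \<delta>)\<close> with
  probability at most \<open>2\<^sup>k\<^sup>-\<^sup>n\<close> over \<open>a\<close>. The decoder picks any message whose codeword is a neighbour
  of the received word. It can err only if one of the at most \<open>2\<^sup>t\<close> neighbours \<open>x' \<noteq> x\<close> is a
  codeword as well, which has probability at most \<open>2\<^sup>t\<^sup>+\<^sup>k\<^sup>-\<^sup>n\<close>. This avoids arithmetic in a field with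
  \<open>2\<^sup>n\<close> elements, so that an explicit Turing machine computes the code in quadratic time.
\<close>

section \<open>Resilience from pair counting\<close>

text \<open>\<open>Max\<close> bounds its members only on a finite set. The degrees form one even
  for infinite \<open>Y\<close>, since none exceeds \<open>card X\<close>.\<close>

lemma card_neighbours_le:
  assumes "finite X" "hamming_channel X Y E" "distortion Y E \<le> b" "y \<in> Y"
  shows "card {x. (x, y) \<in> E} \<le> b"
proof -
  have "{x. (x, z) \<in> E} \<subseteq> X" for z
    using assms(2) by (auto simp: hamming_channel_def)
  then have "card {x. (x, z) \<in> E} \<le> card X" for z
    using assms(1) by (simp add: card_mono)
  then have "(\<lambda>y. card {x. (x, y) \<in> E}) ` Y \<subseteq> {..card X}" by auto
  then have "finite ((\<lambda>y. card {x. (x, y) \<in> E}) ` Y)"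
    using finite_subset by blast
  then have "card {x. (x, y) \<in> E} \<le> distortion Y E"
    unfolding distortion_def using assms(4) by (intro Max_ge) auto
  then show ?thesis using assms(3) by simp
qed

text \<open>Union bound: a decoding error puts \<rho> into the set counted by \<open>pair\<close>
  for the sent codeword x and some other neighbour x' of the received word. There are
  \<open>card X\<close> choices of x, and at most \<open>2 ^ t\<close> of x' for each.\<close>

lemma hamming_resilient_by_counting:
  assumes fX: "finite X" and fR: "finite R" "R \<noteq> {}" and neM: "M \<noteq> {}"
    and Enc: "Enc \<in> M \<times> R \<rightarrow> X"
    and inj: "\<And>\<rho>. \<rho> \<in> R \<Longrightarrow> inj_on (\<lambda>m. Enc (m, \<rho>)) M"
    and pair: "\<And>m x x'. m \<in> M \<Longrightarrow> x \<noteq> x' \<Longrightarrow>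
      card {\<rho>\<in>R. Enc (m, \<rho>) = x \<and> (\<exists>m'\<in>M. Enc (m', \<rho>) = x')} \<le> c"
    and bound: "real (card X * 2 ^ t * c) \<le> \<epsilon> * real (card R)"
  shows "hamming_resilient t \<epsilon> M R X Enc"
  unfolding hamming_resilient_def
proof (intro allI impI, elim conjE)
  fix Y :: "nat set" and E
  assume ch: "hamming_channel X Y E" and dist: "distortion Y E \<le> 2 ^ t"
  obtain m0 where m0: "m0 \<in> M" using neM by blast
  \<comment> \<open>The default \<open>m0\<close> keeps the value in \<open>M\<close> when no
    codeword is a neighbour of y; for a word produced by a channel function the sent message is
    itself a candidate.\<close>
  define Dec where "Dec = (\<lambda>(y, \<rho>). if \<exists>m'\<in>M. (Enc (m', \<rho>), y) \<in> E
      then SOME m'. m' \<in> M \<and> (Enc (m', \<rho>), y) \<in> E else m0)"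
  have Dec: "Dec (y, \<rho>) \<in> M \<and> (Enc (Dec (y, \<rho>), \<rho>), y) \<in> E"
    if "m' \<in> M" "(Enc (m', \<rho>), y) \<in> E" for m' y \<rho>
  proof -
    have "\<exists>m'. m' \<in> M \<and> (Enc (m', \<rho>), y) \<in> E" using that by blast
    from someI_ex[OF this] show ?thesis using that by (auto simp: Dec_def)
  qed
  show "decodable \<epsilon> M R X Enc Y E" unfolding decodable_def
  proof (intro bexI allI impI ballI)
    show "Dec \<in> Y \<times> R \<rightarrow> M"
    proof
      fix p assume "p \<in> Y \<times> R"
      obtain y \<rho> where p: "p = (y, \<rho>)" by fastforce
      show "Dec p \<in> M"
      proof (cases "\<exists>m'\<in>M. (Enc (m', \<rho>), y) \<in> E")
        case True then show ?thesis using Dec p by blast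
      next
        case False then show ?thesis using m0 p by (simp add: Dec_def)
      qed
    qed
  next
    fix Ch m assume C: "channel_function X E Ch" and m: "m \<in> M"
    \<comment> \<open>\<open>Ch\<close> sees only the codeword, so the rivals \<open>N x\<close> do
      not depend on \<rho>; this is what lets the error event be split into pairs x, x'.\<close>
    define N where "N x = {x'. (x', Ch x) \<in> E} - {x}" for x
    define P where "P x x' = {\<rho>\<in>R. Enc (m, \<rho>) = x \<and> (\<exists>m'\<in>M. Enc (m', \<rho>) = x')}" for x x'
    let ?good = "{\<rho>. Dec (Ch (Enc (m, \<rho>)), \<rho>) = m}"
    have edge: "(x, Ch x) \<in> E" if "x \<in> X" for x
      using C that by (simp add: channel_function_def)
    have NX: "N x \<subseteq> X" for x using ch by (auto simp: hamming_channel_def N_def)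
    then have fN: "finite (N x)" for x using fX finite_subset by blast
    have cN: "card (N x) \<le> 2 ^ t" if "x \<in> X" for x
    proof -
      have "Ch x \<in> Y" using edge[OF that] ch by (auto simp: hamming_channel_def)
      from card_neighbours_le[OF fX ch dist this]
      have "card {x'. (x', Ch x) \<in> E} \<le> 2 ^ t" .
      then show ?thesis unfolding N_def by (rule order_trans[OF card_Diff1_le])
    qed
    have sub: "R - ?good \<subseteq> (\<Union>x\<in>X. \<Union>x'\<in>N x. P x x')"
    proof
      fix \<rho> assume "\<rho> \<in> R - ?good"
      then have \<rho>: "\<rho> \<in> R" and bad: "Dec (Ch (Enc (m, \<rho>)), \<rho>) \<noteq> m" by auto
      let ?x = "Enc (m, \<rho>)" and ?m' = "Dec (Ch (Enc (m, \<rho>)), \<rho>)"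
      have x: "?x \<in> X" using Enc m \<rho> by auto
      have m': "?m' \<in> M" "(Enc (?m', \<rho>), Ch ?x) \<in> E" using Dec[OF m edge[OF x]] by auto
      \<comment> \<open>For fixed \<rho> distinct messages have distinct codewords, so a wrong
        answer exhibits a neighbour other than x.\<close>
      have "Enc (?m', \<rho>) \<noteq> ?x" using inj_onD[OF inj[OF \<rho>] _ m'(1) m] bad by auto
      then show "\<rho> \<in> (\<Union>x\<in>X. \<Union>x'\<in>N x. P x x')"
        using x m' \<rho> by (auto simp: N_def P_def)
    qed
    have "card (R - ?good) \<le> card (\<Union>x\<in>X. \<Union>x'\<in>N x. P x x')"
      using sub fX fN fR by (intro card_mono) (auto simp: P_def)
    also have "\<dots> \<le> (\<Sum>x\<in>X. card (\<Union>x'\<in>N x. P x x'))" by (rule card_UN_le[OF fX])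
    also have "\<dots> \<le> (\<Sum>x\<in>X. 2 ^ t * c)"
    proof (rule sum_mono)
      fix x assume x: "x \<in> X"
      have "card (\<Union>x'\<in>N x. P x x') \<le> (\<Sum>x'\<in>N x. card (P x x'))" by (rule card_UN_le[OF fN])
      also have "\<dots> \<le> (\<Sum>x'\<in>N x. c)"
        using pair[OF m] by (intro sum_mono) (auto simp: P_def N_def)
      also have "\<dots> \<le> 2 ^ t * c" using cN[OF x] by simp
      finally show "card (\<Union>x'\<in>N x. P x x') \<le> 2 ^ t * c" .
    qed
    also have "\<dots> = card X * 2 ^ t * c" by simp
    finally have "real (card (R - ?good)) \<le> \<epsilon> * real (card R)"
      using bound by (meson of_nat_le_iff order_trans)
    moreover have "real (card (R - ?good)) = real (card R) - real (card (R \<inter> ?good))"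
      using fR card_Int_Diff[of R ?good] by simp
    moreover have "measure_pmf.prob (pmf_of_set R) ?good = real (card (R \<inter> ?good)) / real (card R)"
      using fR by (simp add: measure_pmf_of_set)
    moreover have "real (card R) > 0" using fR by (simp add: card_gt_0_iff)
    ultimately have "real (card R) * (1 - \<epsilon>) \<le> real (card R) * measure_pmf.prob (pmf_of_set R) ?good"
      and "real (card R) > 0" by (simp_all add: algebra_simps)
    then show "measure_pmf.prob (pmf_of_set R) ?good \<ge> 1 - \<epsilon>"
      by (simp only: mult_le_cancel_left_pos)
  qed
qed

text \<open>A constant decoder suffices: for \<open>\<epsilon> \<ge> 1\<close> the required
  probability is at most 0, and a single message is always guessed right. The degenerate parameters
  of the final theorem are handled this way.\<close>

lemma hamming_resilient_trivial:
  assumes "M \<noteq> {}" and "\<epsilon> \<ge> 1 \<or> is_singleton M \<and> \<epsilon> \<ge> 0"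
  shows "hamming_resilient t \<epsilon> M R X Enc"
proof -
  obtain m0 where m0: "m0 \<in> M" using assms(1) by blast
  have "measure_pmf.prob (pmf_of_set R) {\<rho>. (\<lambda>_. m0) (Ch (Enc (m, \<rho>)), \<rho>) = m} \<ge> 1 - \<epsilon>"
    if "m \<in> M" for m and Ch :: "_ \<Rightarrow> nat"
    using assms(2)
  proof
    assume "\<epsilon> \<ge> 1"
    then show ?thesis by (smt (verit) measure_nonneg)
  next
    assume "is_singleton M \<and> \<epsilon> \<ge> 0"
    then have "m0 = m" "\<epsilon> \<ge> 0" using m0 that by (auto simp: is_singleton_def)
    then show ?thesis by simp
  qed
  then show ?thesis unfolding hamming_resilient_def decodable_def
    using m0 by (intro allI impI bexI[of _ "\<lambda>_. m0"] ballI) auto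
qed

section \<open>The Toeplitz code\<close>

lemma bitstrings_eq: "bitstrings n = {w. set w \<subseteq> UNIV \<and> length w = n}"
  by (simp add: bitstrings_def)

lemma finite_bitstrings [simp]: "finite (bitstrings n)"
  unfolding bitstrings_eq by (rule finite_lists_length_eq) simp

lemma card_bitstrings [simp]: "card (bitstrings n) = 2 ^ n"
  unfolding bitstrings_eq by (subst card_lists_length_eq) (auto simp: card_UNIV_bool)

lemma bitstrings_nonempty [simp]: "bitstrings n \<noteq> {}"
  using card_bitstrings[of n] by (metis card.empty power_not_zero zero_neq_numeral)

text \<open>At \<open>j = 0\<close> this is row i of the matrix-vector product; larger j gives the
  partial parities met when m is read from right to left. The entry \<open>a (i + 1 + l)\<close>
  depends on i + l only, which is the Toeplitz pattern once the message is reversed.\<close>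

definition toeplitz_bit :: "bool list \<Rightarrow> (nat \<Rightarrow> bool) \<Rightarrow> nat \<Rightarrow> nat \<Rightarrow> bool" where
  "toeplitz_bit m a i j = odd (\<Sum>l\<in>{j..<length m}. of_bool (m ! l \<and> a (i + 1 + l)) :: nat)"

text \<open>
  The two halves of \<open>\<rho>\<close> are interleaved, and the message bits stand in reverse order at the
  end of the codeword, so that the Turing machine below can work without searching for positions.
\<close>

definition code_bit :: "bool list \<Rightarrow> (nat \<Rightarrow> bool) \<Rightarrow> nat \<Rightarrow> nat \<Rightarrow> bool" where
  "code_bit m a n i =
     (if n - length m \<le> i then m ! (n - 1 - i) else toeplitz_bit m a i 0)"

definition toeplitz_enc :: "bool list \<times> bool list \<Rightarrow> bool list" where
  "toeplitz_enc = (\<lambda>(m, \<rho>). let n = length \<rho> div 2 in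
     map (\<lambda>i. \<rho> ! (2 * i + 1) \<noteq> code_bit m (\<lambda>l. \<rho> ! (2 * l)) n i) [0..<n])"

lemma length_toeplitz_enc [simp]: "length (toeplitz_enc (m, \<rho>)) = length \<rho> div 2"
  by (simp add: toeplitz_enc_def Let_def)

lemma nth_toeplitz_enc:
  assumes "length \<rho> = 2 * n" "i < n"
  shows "toeplitz_enc (m, \<rho>) ! i \<longleftrightarrow> \<rho> ! (2 * i + 1) \<noteq> code_bit m (\<lambda>l. \<rho> ! (2 * l)) n i"
  using assms by (simp add: toeplitz_enc_def Let_def)

text \<open>The end of the codeword is the masked message, so unmasking returns it. This yields
  injectivity and, in the pair count, a rival message common to all \<rho>.\<close>

lemma toeplitz_enc_message_bit:
  assumes "length \<rho> = 2 * n" "length m = k" "k \<le> n" "j < k"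
  shows "m ! j \<longleftrightarrow> \<rho> ! (2 * (n - 1 - j) + 1) \<noteq> toeplitz_enc (m, \<rho>) ! (n - 1 - j)"
proof -
  have "n - 1 - j < n" "n - k \<le> n - 1 - j" "n - 1 - (n - 1 - j) = j" using assms by auto
  then show ?thesis using assms by (auto simp: nth_toeplitz_enc code_bit_def)
qed

lemma toeplitz_enc_inj:
  assumes "length \<rho> = 2 * n" "k \<le> n"
  shows "inj_on (\<lambda>m. toeplitz_enc (m, \<rho>)) (bitstrings k)"
proof (rule inj_onI)
  fix m m' assume m: "m \<in> bitstrings k" "m' \<in> bitstrings k"
    and eq: "toeplitz_enc (m, \<rho>) = toeplitz_enc (m', \<rho>)"
  show "m = m'"
  proof (rule nth_equalityI)
    show "length m = length m'" using m by (simp add: bitstrings_def)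
  next
    fix j assume "j < length m"
    then show "m ! j = m' ! j"
      using toeplitz_enc_message_bit[OF assms(1), of _ k j] assms(2) m eq
      by (simp add: bitstrings_def)
  qed
qed

text \<open>
  At the last position \<open>J\<close> where the two messages differ, the equation for output bit \<open>i\<close> can be
  solved for \<open>a (i + 1 + J)\<close> in terms of the values of \<open>a\<close> at smaller arguments.
\<close>

lemma toeplitz_solve:
  assumes len: "length m' = length m" and J: "J < length m" "m ! J \<noteq> m' ! J"
    and above: "\<And>j. J < j \<Longrightarrow> j < length m \<Longrightarrow> m ! j = m' ! j"
    and below: "\<And>j. j < J \<Longrightarrow> a (i + 1 + j) = a' (i + 1 + j)"
    and eq: "(toeplitz_bit m a i 0 = toeplitz_bit m' a i 0) =
      (toeplitz_bit m a' i 0 = toeplitz_bit m' a' i 0)"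
  shows "a (i + 1 + J) = a' (i + 1 + J)"
proof -
  \<comment> \<open>\<open>f j\<close> collects the four terms of position j. Below J they pair up
    because \<open>a\<close> and \<open>a'\<close> agree, above J because the messages agree; at J
    exactly one message has a 1, which leaves the sum of the two unknown bits.\<close>
  define f where "f j = (of_bool (m ! j \<and> a (i + 1 + j)) + of_bool (m' ! j \<and> a (i + 1 + j))
    + (of_bool (m ! j \<and> a' (i + 1 + j)) + of_bool (m' ! j \<and> a' (i + 1 + j))) :: nat)" for j
  have "even (\<Sum>j\<in>{0..<length m}. f j)"
    using eq by (simp add: f_def sum.distrib toeplitz_bit_def len)
  moreover have "(\<Sum>j\<in>{0..<length m}. f j) = f J + (\<Sum>j\<in>{0..<length m} - {J}. f j)"
    using J by (intro sum.remove) auto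
  moreover have "even (\<Sum>j\<in>{0..<length m} - {J}. f j)"
  proof (rule dvd_sum)
    fix j assume "j \<in> {0..<length m} - {J}"
    then consider "j < J" | "J < j" "j < length m" by fastforce
    then show "even (f j)"
      by cases (simp_all add: f_def above below[simplified])
  qed
  ultimately have "even (f J)" by simp
  then show ?thesis using J by (auto simp: f_def split: if_splits)
qed

text \<open>All \<rho> in the set share one rival message m'. The first \<open>n - k\<close> output
  bits then determine \<open>n - k\<close> bits of \<open>a\<close> from the other k, and x
  determines the mask, so k bits fix \<rho>.\<close>

lemma toeplitz_enc_pair_count:
  assumes "k \<le> n" and m: "m \<in> bitstrings k" and "x \<noteq> x'"
  shows "card {\<rho>\<in>bitstrings (2 * n). toeplitz_enc (m, \<rho>) = x \<and>
    (\<exists>m'\<in>bitstrings k. toeplitz_enc (m', \<rho>) = x')} \<le> 2 ^ k" (is "card ?S \<le> _")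
proof (cases "?S = {}")
  case False
  define A where "A \<rho> = (\<lambda>l. \<rho> ! (2 * l))" for \<rho> :: "bool list"
  have lenm: "length m = k" using m by (simp add: bitstrings_def)
  obtain \<rho>0 m' where m': "m' \<in> bitstrings k" and \<rho>0: "length \<rho>0 = 2 * n"
    and x0: "toeplitz_enc (m, \<rho>0) = x" "toeplitz_enc (m', \<rho>0) = x'"
    using False by (auto simp: bitstrings_def)
  have lenm': "length m' = k" using m' by (simp add: bitstrings_def)
  have uniq: "toeplitz_enc (m', \<rho>) = x'" "toeplitz_enc (m, \<rho>) = x" "length \<rho> = 2 * n"
    if S: "\<rho> \<in> ?S" for \<rho>
  proof -
    from S obtain m'' where m'': "length m'' = k" "toeplitz_enc (m'', \<rho>) = x'"
      by (auto simp: bitstrings_def)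
    show \<rho>: "toeplitz_enc (m, \<rho>) = x" "length \<rho> = 2 * n" using S by (auto simp: bitstrings_def)
    \<comment> \<open>The mask cancels: bit j of the rival is \<open>m ! j\<close> xored with the
      bits of x and x' at \<open>n - 1 - j\<close>, whatever \<rho> is.\<close>
    have "m'' = m'"
    proof (rule nth_equalityI)
      fix j assume "j < length m''"
      then have j: "j < k" using m'' by simp
      show "m'' ! j = m' ! j"
        using toeplitz_enc_message_bit[OF \<rho>0 lenm assms(1) j]
          toeplitz_enc_message_bit[OF \<rho>0 lenm' assms(1) j]
          toeplitz_enc_message_bit[OF \<rho>(2) lenm assms(1) j]
          toeplitz_enc_message_bit[OF \<rho>(2) m''(1) assms(1) j]
        unfolding x0 \<rho> m'' by blast
    qed (simp add: m'' lenm')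
    then show "toeplitz_enc (m', \<rho>) = x'" using m'' by simp
  qed
  define D where "D = {j. j < k \<and> m ! j \<noteq> m' ! j}"
  have "m \<noteq> m'" using x0 \<open>x \<noteq> x'\<close> by auto
  then have "D \<noteq> {}" using lenm lenm' by (auto simp: D_def list_eq_iff_nth_eq)
  moreover have "finite D" by (simp add: D_def)
  ultimately have J: "Max D \<in> D" and above: "\<And>j. Max D < j \<Longrightarrow> j < k \<Longrightarrow> m ! j = m' ! j"
    using Max_in[of D] Max_ge[of D] by (auto simp: D_def not_less[symmetric])
  define J where "J = Max D"
  note J = J[folded J_def] above[folded J_def]
  have Jk: "J < k" "m ! J \<noteq> m' ! J" using J by (auto simp: D_def)
  \<comment> \<open>Row i is solved for \<open>a (i + 1 + J)\<close>, so the rows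
    \<open>i < n - k\<close> cover the removed interval. It lies below n because
    \<open>J < k\<close>; the k indices left are free.\<close>
  define F where "F = {..<n} - {J + 1..<J + 1 + (n - k)}"
  have "inj_on (\<lambda>\<rho>. {l\<in>F. A \<rho> l}) ?S"
  proof (rule inj_onI)
    fix \<rho> \<sigma> assume \<rho>: "\<rho> \<in> ?S" and \<sigma>: "\<sigma> \<in> ?S" and eq: "{l\<in>F. A \<rho> l} = {l\<in>F. A \<sigma> l}"
    note u\<rho> = uniq[OF \<rho>] and u\<sigma> = uniq[OF \<sigma>]
    have code: "code_bit m (A \<tau>) n i \<longleftrightarrow> \<tau> ! (2 * i + 1) \<noteq> x ! i"
      "code_bit m' (A \<tau>) n i \<longleftrightarrow> \<tau> ! (2 * i + 1) \<noteq> x' ! i" if "\<tau> \<in> ?S" "i < n" for \<tau> i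
      using nth_toeplitz_enc[OF uniq(3)[OF that(1)] that(2), of m]
        nth_toeplitz_enc[OF uniq(3)[OF that(1)] that(2), of m'] uniq(1,2)[OF that(1)]
      by (auto simp: A_def)
    have A: "A \<rho> l = A \<sigma> l" if "l < n" for l
      using that
    proof (induction l rule: less_induct)
      case (less l)
      show ?case
      proof (cases "l \<in> F")
        case True then show ?thesis using eq by auto
      next
        case False
        \<comment> \<open>The row whose equation has \<open>a l\<close> at the last differing
          position J; its earlier entries have smaller index and are known by induction.\<close>
        define i where "i = l - 1 - J"
        have l: "l = i + 1 + J" and i: "i < n - k" "i < n"
          using False less.prems by (auto simp: F_def i_def)
        have "A \<rho> (i + 1 + J) = A \<sigma> (i + 1 + J)"
        proof (rule toeplitz_solve[of m' m])
          show "A \<rho> (i + 1 + j) = A \<sigma> (i + 1 + j)" if "j < J" for j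
            using less that l by simp
          \<comment> \<open>The mask bit cancels: both sides say whether x and x' agree at position
            i.\<close>
          show "(toeplitz_bit m (A \<rho>) i 0 = toeplitz_bit m' (A \<rho>) i 0) =
              (toeplitz_bit m (A \<sigma>) i 0 = toeplitz_bit m' (A \<sigma>) i 0)"
            using code[OF \<rho> i(2)] code[OF \<sigma> i(2)] i(1) lenm lenm'
            unfolding code_bit_def by auto
        qed (use Jk J lenm lenm' in auto)
        then show ?thesis using l by simp
      qed
    qed
    \<comment> \<open>Rows \<open>i < n - k\<close> read \<open>a\<close> only up to index
      \<open>n - 1\<close>, where \<open>A\<close> is already known. The mask then follows by xoring
      the code bit with x.\<close>
    have cong: "code_bit m (A \<rho>) n i = code_bit m (A \<sigma>) n i" if "i < n" for i
      unfolding code_bit_def toeplitz_bit_def using lenm that A by (auto intro!: arg_cong[of _ _ odd] sum.cong)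
    show "\<rho> = \<sigma>"
    proof (rule nth_equalityI)
      show "length \<rho> = length \<sigma>" using u\<rho> u\<sigma> by simp
    next
      fix j assume "j < length \<rho>"
      then have i: "j div 2 < n" using u\<rho> by simp
      show "\<rho> ! j = \<sigma> ! j"
      proof (cases "even j")
        case True then show ?thesis using A[OF i] by (simp add: A_def)
      next
        case False
        then have "j = 2 * (j div 2) + 1" by simp
        then show ?thesis using code[OF \<rho> i] code[OF \<sigma> i] cong[OF i] by metis
      qed
    qed
  qed
  then have "card ?S \<le> card (Pow F)"
    by (rule card_inj_on_le) (auto simp: F_def)
  also have "\<dots> = 2 ^ card F" by (simp add: card_Pow F_def)
  also have "card F = k"
  proof -
    have "card F = card {..<n} - card {J + 1..<J + 1 + (n - k)}"
      unfolding F_def using Jk assms(1) by (intro card_Diff_subset) auto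
    then show ?thesis using assms(1) by simp
  qed
  finally show ?thesis .
next
  case True
  show ?thesis unfolding True by simp
qed

text \<open>The count is \<open>2 ^ n\<close> codewords times \<open>2 ^ t\<close> neighbours times
  \<open>2 ^ k\<close> strings per pair, out of \<open>2 ^ (2 * n)\<close> strings.\<close>

lemma toeplitz_enc_resilient:
  assumes "k \<le> n" and "2 ^ (t + k) \<le> \<epsilon> * 2 ^ n"
  shows "hamming_resilient t \<epsilon> (bitstrings k) (bitstrings (2 * n)) (bitstrings n) toeplitz_enc"
proof (rule hamming_resilient_by_counting)
  show "toeplitz_enc \<in> bitstrings k \<times> bitstrings (2 * n) \<rightarrow> bitstrings n"
    by (auto simp: bitstrings_def)
  show "inj_on (\<lambda>m. toeplitz_enc (m, \<rho>)) (bitstrings k)" if "\<rho> \<in> bitstrings (2 * n)" for \<rho>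
    using that assms(1) by (intro toeplitz_enc_inj) (auto simp: bitstrings_def)
  show "real (card (bitstrings n) * 2 ^ t * 2 ^ k) \<le> \<epsilon> * real (card (bitstrings (2 * n)))"
  proof -
    have "real (card (bitstrings n) * 2 ^ t * 2 ^ k) = 2 ^ n * 2 ^ (t + k)"
      by (simp add: power_add)
    also have "\<dots> \<le> 2 ^ n * (\<epsilon> * 2 ^ n)" using assms(2) by simp
    also have "\<dots> = \<epsilon> * real (card (bitstrings (2 * n)))"
      by (simp add: power_even_eq power2_eq_square)
    finally show ?thesis .
  qed
qed (use toeplitz_enc_pair_count[OF assms(1)] in auto)

section \<open>The encoding machine\<close>

definition bit_symbol :: "bool \<Rightarrow> nat" where
  "bit_symbol b = (if b then 2 else 1)"

text \<open>\<open>3 - y\<close> exchanges the bit symbols 1 and 2. A blank would become 3, outside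
  the alphabet, so the transitions test for \<open>y = 0\<close> first.\<close>

definition symbol_xor :: "nat \<Rightarrow> bool \<Rightarrow> nat" where
  "symbol_xor y b = (if b then 3 - y else y)"

text \<open>
  The tapes hold the message, \<open>\<rho>\<close>, the output and a copy of \<open>a\<close>. States 0 and 1 distribute the
  bits of \<open>\<rho>\<close> to the last two tapes. State 2 adds the message to the end of the output, from right
  to left. State 3 adds the inner product of the message with a window of \<open>a\<close> to one output bit,
  and state 4 rewinds the message and shifts the window.
\<close>

definition enc_transition ::
  "nat \<Rightarrow> nat list \<Rightarrow> (nat \<times> (nat \<times> head_move) list) option" where
  "enc_transition q syms = (case syms of
     [x, r, y, z] \<Rightarrow>
       (if x > 2 \<or> r > 2 \<or> y > 2 \<or> z > 2 then None
        else if q = 0 then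
          (if r = 0 then Some (2, [(x, Stay), (r, Stay), (y, Move_Left), (z, Stay)])
           else Some (1, [(x, Stay), (r, Move_Right), (y, Stay), (r, Move_Right)]))
        else if q = 1 then
          Some (0, [(x, Stay), (r, Move_Right), (r, Move_Right), (z, Stay)])
        else if q = 2 then
          (if x = 0 then Some (4, [(x, Stay), (r, Stay), (y, Stay), (z, Stay)])
           else if y = 0 then None
           else Some (2, [(x, Move_Right), (r, Stay), (symbol_xor y (x = 2), Move_Left), (z, Stay)]))
        else if q = 3 then
          (if x = 0 then Some (4, [(x, Move_Right), (r, Stay), (y, Move_Left), (z, Stay)])
           else if y = 0 then None
           else Some (3, [(x, Move_Left), (r, Stay),
             (symbol_xor y (x = 2 \<and> z = 2), Stay), (z, Move_Left)]))
        else
          (if x \<noteq> 0 then Some (4, [(x, Move_Right), (r, Stay), (y, Stay), (z, Move_Right)])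
           else if y = 0 then None
           else Some (3, [(x, Move_Left), (r, Stay), (y, Stay), (z, Move_Left)])))
   | _ \<Rightarrow> None)"

definition enc_machine :: turing_machine where
  "enc_machine = \<lparr>num_tapes = 4, num_symbols = 3, num_states = 5, transition = enc_transition\<rparr>"

lemma wf_enc_machine: "wf_turing_machine enc_machine"
  unfolding wf_turing_machine_def enc_machine_def
  by (auto simp: enc_transition_def symbol_xor_def split: list.splits if_splits)

text \<open>Contents are given by a length and a function instead of a list, so that overwriting a
  cell is a function update and appending one increases the length.\<close>

definition bit_tape :: "nat \<Rightarrow> (nat \<Rightarrow> bool) \<Rightarrow> int \<Rightarrow> nat" where
  "bit_tape n f i = (if 0 \<le> i \<and> i < int n then bit_symbol (f (nat i)) else 0)"

lemma tape_contents_eq_bit_tape: "tape_contents w = bit_tape (length w) ((!) w)"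
  by (rule ext) (simp add: tape_contents_def bit_tape_def bit_symbol_def)

lemma bit_tape_cong: "(\<And>i. i < n \<Longrightarrow> f i = g i) \<Longrightarrow> bit_tape n f = bit_tape n g"
  by (rule ext) (simp add: bit_tape_def nat_less_iff)

lemma bit_tape_0: "bit_tape 0 f = (\<lambda>_. 0)"
  by (rule ext) (simp add: bit_tape_def)

lemma bit_tape_le: "bit_tape n f i \<le> 2"
  by (simp add: bit_tape_def bit_symbol_def)

lemma bit_tape_nth: "i < n \<Longrightarrow> bit_tape n f (int i) = bit_symbol (f i)"
  by (simp add: bit_tape_def)

lemma bit_tape_blank: "i < 0 \<or> int n \<le> i \<Longrightarrow> bit_tape n f i = 0"
  by (auto simp: bit_tape_def)

lemma bit_tape_snoc: "(bit_tape n f)(int n := bit_symbol (f n)) = bit_tape (Suc n) f"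
  by (rule ext) (auto simp: bit_tape_def)

lemma bit_tape_update:
  "i < n \<Longrightarrow> (bit_tape n f)(int i := bit_symbol b) = bit_tape n (f(i := b))"
  by (rule ext) (auto simp: bit_tape_def)

lemma symbol_xor_bit_symbol: "symbol_xor (bit_symbol c) b = bit_symbol (c \<noteq> b)"
  by (auto simp: symbol_xor_def bit_symbol_def)

lemma bit_symbol_simps: "bit_symbol b \<noteq> 0" "0 < bit_symbol b" "bit_symbol b \<le> 2" "bit_symbol b = 2 \<longleftrightarrow> b"
  by (auto simp: bit_symbol_def)

section \<open>Runs of the single phases of the machine\<close>

lemma enc_step:
  "tm_step enc_machine (q, [(h0, f0), (h1, f1), (h2, f2), (h3, f3)]) =
    (case enc_transition q [f0 h0, f1 h1, f2 h2, f3 h3] of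
       None \<Rightarrow> (q, [(h0, f0), (h1, f1), (h2, f2), (h3, f3)])
     | Some (q', acts) \<Rightarrow> (q', map2 act_tape acts [(h0, f0), (h1, f1), (h2, f2), (h3, f3)]))"
  by (simp add: enc_machine_def)

lemma enc_split_steps:
  assumes "i \<le> n" "\<rho> = bit_tape (2 * n) f" "\<mu> = bit_tape k g"
  shows "(tm_step enc_machine ^^ (2 * i))
      (0, [(0, \<mu>), (0, \<rho>), (0, bit_tape 0 (\<lambda>l. f (2 * l + 1))), (0, bit_tape 0 (\<lambda>l. f (2 * l)))]) =
      (0, [(0, \<mu>), (int (2 * i), \<rho>), (int i, bit_tape i (\<lambda>l. f (2 * l + 1))),
        (int i, bit_tape i (\<lambda>l. f (2 * l)))])"
  using assms(1)
proof (induction i)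
  case (Suc i)
  let ?b = "\<lambda>l. f (2 * l + 1)" and ?a = "\<lambda>l. f (2 * l)"
  have r: "\<rho> (int (2 * i)) = bit_symbol (?a i)" "\<rho> (int (2 * i + 1)) = bit_symbol (?b i)"
    unfolding assms(2) using Suc.prems by (simp_all only: bit_tape_nth)
  have 1: "tm_step enc_machine (0, [(0, \<mu>), (int (2 * i), \<rho>), (int i, bit_tape i ?b), (int i, bit_tape i ?a)])
    = (1, [(0, \<mu>), (int (2 * i + 1), \<rho>), (int i, bit_tape i ?b), (int (Suc i), bit_tape (Suc i) ?a)])"
    using r bit_tape_snoc[of i ?a] unfolding enc_step assms(3)
    by (simp add: enc_transition_def bit_tape_le bit_symbol_simps not_less fun_upd_idem)
  have 2: "tm_step enc_machine (1, [(0, \<mu>), (int (2 * i + 1), \<rho>), (int i, bit_tape i ?b), (int (Suc i), bit_tape (Suc i) ?a)])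
    = (0, [(0, \<mu>), (int (2 * Suc i), \<rho>), (int (Suc i), bit_tape (Suc i) ?b), (int (Suc i), bit_tape (Suc i) ?a)])"
    using r bit_tape_snoc[of i ?b] unfolding enc_step assms(3)
    by (simp add: enc_transition_def bit_tape_le bit_symbol_simps not_less fun_upd_idem)
  have "2 * Suc i = Suc (Suc (2 * i))" by simp
  then show ?case using Suc 1 2 by (simp only: funpow.simps o_apply)
qed simp


text \<open>The message head moves right while the output head moves left, so message bit j meets
  output bit \<open>n - 1 - j\<close>.\<close>

lemma enc_message_steps:
  assumes "j \<le> n" "j \<le> k"
  shows "(tm_step enc_machine ^^ j)
      (2, [(0, bit_tape k g), (h, bit_tape r f), (int n - 1, bit_tape n b), (h', bit_tape l a)]) =
      (2, [(int j, bit_tape k g), (h, bit_tape r f),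
        (int n - 1 - int j, bit_tape n (\<lambda>i. if n - j \<le> i then b i \<noteq> g (n - 1 - i) else b i)),
        (h', bit_tape l a)])" (is "_ = (2, ?c j)")
  using assms
proof (induction j)
  case 0
  have "bit_tape n b = bit_tape n (\<lambda>i. if n - 0 \<le> i then b i \<noteq> g (n - 1 - i) else b i)"
    by (rule bit_tape_cong) simp
  then show ?case by simp
next
  case (Suc j)
  let ?f = "\<lambda>j i. if n - j \<le> i then b i \<noteq> g (n - 1 - i) else b i"
  define p where "p = n - 1 - j"
  have p: "p < n" "int n - 1 - int j = int p" "n - 1 - p = j" "\<not> n - j \<le> p"
    using Suc.prems by (auto simp: p_def)
  \<comment> \<open>The cell under the output head still holds its mask bit, as
    \<open>p < n - j\<close>.\<close>
  have fj: "?f j p = b p" using p by simp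
  have upd: "bit_tape n ((?f j)(p := b p \<noteq> g j)) = bit_tape n (?f (Suc j))"
    using Suc.prems by (intro bit_tape_cong) (auto simp: p_def)
  have "tm_step enc_machine (2, ?c j) = (2, ?c (Suc j))"
    using Suc.prems p(2) bit_tape_nth[OF p(1), of "?f j"] bit_tape_nth[of j k g]
      bit_tape_update[OF p(1), of "?f j" "b p \<noteq> g j"]
    unfolding enc_step fj upd
    by (simp add: enc_transition_def bit_tape_le bit_symbol_simps symbol_xor_bit_symbol not_less fun_upd_idem)
  then show ?case using Suc by simp
qed

text \<open>The parity accumulates in the output cell itself. The heads at \<open>j - 1\<close> and
  \<open>i + j\<close> are on the next factors, since \<open>i + j = i + 1 + (j - 1)\<close>; each
  step prepends one term to the partial parity.\<close>

lemma enc_sweep_steps: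
  assumes "k = length m" "j + s = k" "i < n" "i + k < l"
  shows "(tm_step enc_machine ^^ s)
      (3, [(int k - 1, bit_tape k ((!) m)), (h, bit_tape r f), (int i, bit_tape n b),
        (int (i + k), bit_tape l a)]) =
      (3, [(int j - 1, bit_tape k ((!) m)), (h, bit_tape r f),
        (int i, bit_tape n (b(i := b i \<noteq> toeplitz_bit m a i j))), (int (i + j), bit_tape l a)])"
  using assms(2)
proof (induction s arbitrary: j)
  case 0
  have "\<not> toeplitz_bit m a i k" by (simp add: toeplitz_bit_def assms(1))
  then show ?case using 0 by simp
next
  case (Suc s)
  let ?t = "toeplitz_bit m a i"
  let ?b = "\<lambda>j. b(i := b i \<noteq> ?t j)"
  have j: "j < k" "i + Suc j < l" using Suc.prems assms by auto
  have "j < length m" using j assms(1) by simp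
  from sum.atLeast_Suc_lessThan[OF this, of "\<lambda>l. of_bool (m ! l \<and> a (i + 1 + l)) :: nat"]
  have t: "?t j \<longleftrightarrow> ?t (Suc j) \<noteq> (m ! j \<and> a (i + Suc j))"
    unfolding toeplitz_bit_def by auto
  have upd: "(?b (Suc j))(i := (b i \<noteq> ?t (Suc j)) \<noteq> (m ! j \<and> a (i + Suc j))) = ?b j"
    unfolding t by (rule ext) auto
  have "tm_step enc_machine (3, [(int (Suc j) - 1, bit_tape k ((!) m)), (h, bit_tape r f),
        (int i, bit_tape n (?b (Suc j))), (int (i + Suc j), bit_tape l a)]) =
      (3, [(int j - 1, bit_tape k ((!) m)), (h, bit_tape r f),
        (int i, bit_tape n (?b j)), (int (i + j), bit_tape l a)])"
    using bit_tape_nth[OF j(1), of "(!) m"] bit_tape_nth[OF j(2), of a]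
      bit_tape_nth[OF assms(3), of "?b (Suc j)"]
      bit_tape_update[OF assms(3), of "?b (Suc j)" "(b i \<noteq> ?t (Suc j)) \<noteq> (m ! j \<and> a (i + Suc j))"]
    unfolding enc_step upd
    by (simp add: enc_transition_def bit_tape_le bit_symbol_simps symbol_xor_bit_symbol not_less fun_upd_idem)
  moreover have "Suc j + s = k" using Suc.prems by simp
  ultimately show ?case by (simp only: funpow.simps o_apply Suc.IH)
qed

lemma enc_rewind_steps:
  assumes "j \<le> k"
  shows "(tm_step enc_machine ^^ j)
      (4, [(0, bit_tape k g), (h, bit_tape r f), (h', bit_tape n b), (p, bit_tape l a)]) =
      (4, [(int j, bit_tape k g), (h, bit_tape r f), (h', bit_tape n b), (p + int j, bit_tape l a)])"
  using assms
proof (induction j)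
  case (Suc j)
  have "tm_step enc_machine
      (4, [(int j, bit_tape k g), (h, bit_tape r f), (h', bit_tape n b), (p + int j, bit_tape l a)]) =
      (4, [(int (Suc j), bit_tape k g), (h, bit_tape r f), (h', bit_tape n b), (p + int (Suc j), bit_tape l a)])"
    using bit_tape_nth[of j k g] Suc.prems unfolding enc_step
    by (simp add: enc_transition_def bit_tape_le bit_symbol_simps not_less fun_upd_idem)
  then show ?case using Suc by simp
qed simp

lemma enc_round_steps:
  assumes "k = length m" "i < n" "i + k < l"
  shows "(tm_step enc_machine ^^ (2 * k + 2))
      (4, [(int k, bit_tape k ((!) m)), (h, bit_tape r f), (int i, bit_tape n b),
        (int (Suc i + k), bit_tape l a)]) =
      (4, [(int k, bit_tape k ((!) m)), (h, bit_tape r f),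
        (int i - 1, bit_tape n (b(i := b i \<noteq> toeplitz_bit m a i 0))), (int (i + k), bit_tape l a)])"
    (is "(_ ^^ _) ?c = ?c'")
proof -
  let ?b = "b(i := b i \<noteq> toeplitz_bit m a i 0)"
  have 1: "tm_step enc_machine ?c = (3, [(int k - 1, bit_tape k ((!) m)), (h, bit_tape r f),
      (int i, bit_tape n b), (int (i + k), bit_tape l a)])"
    using bit_tape_nth[OF assms(2), of b] bit_tape_blank[of "int k" k "(!) m"] unfolding enc_step
    by (simp add: enc_transition_def bit_tape_le bit_symbol_simps not_less fun_upd_idem)
  have 2: "tm_step enc_machine (3, [(-1, bit_tape k ((!) m)), (h, bit_tape r f),
      (int i, bit_tape n ?b), (int i, bit_tape l a)]) =
      (4, [(0, bit_tape k ((!) m)), (h, bit_tape r f),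
      (int i - 1, bit_tape n ?b), (int i, bit_tape l a)])"
    using bit_tape_blank[of "-1" k "(!) m"] unfolding enc_step
    by (simp add: enc_transition_def bit_tape_le not_less fun_upd_idem)
  \<comment> \<open>One step into state 3, k sweep steps, one step back to state 4, k rewind steps.
    Rewinding undoes the sweep but not the entering move, so the window shifts left by one
    cell.\<close>
  have "(tm_step enc_machine ^^ (k + 1 + (k + 1))) ?c = ?c'"
    unfolding funpow_add[of "k + 1"] funpow_add[of k] o_apply
    using 1 2 enc_sweep_steps[of k m 0 k i n l h r f b a]
      enc_rewind_steps[of k k "(!) m" h r f "int i - 1" n ?b "int i" l a] assms
    by simp
  moreover have "k + 1 + (k + 1) = 2 * k + 2" by simp
  ultimately show ?thesis by (simp only:)
qed

text \<open>Output bits are treated from \<open>s - 1\<close> down to 0: the first round alters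
  \<open>b\<close> at the top, and the induction hypothesis is applied to the altered
  function.\<close>

lemma enc_rounds_steps:
  assumes "k = length m" "s \<le> n" "s + k \<le> l"
  shows "(tm_step enc_machine ^^ (s * (2 * k + 2)))
      (4, [(int k, bit_tape k ((!) m)), (h, bit_tape r f), (int s - 1, bit_tape n b),
        (int (s + k), bit_tape l a)]) =
      (4, [(int k, bit_tape k ((!) m)), (h, bit_tape r f),
        (-1, bit_tape n (\<lambda>i. if i < s then b i \<noteq> toeplitz_bit m a i 0 else b i)),
        (int k, bit_tape l a)])"
  using assms(2,3)
proof (induction s arbitrary: b)
  case (Suc s)
  let ?b = "b(s := b s \<noteq> toeplitz_bit m a s 0)"
  have eq: "(\<lambda>i. if i < s then ?b i \<noteq> toeplitz_bit m a i 0 else ?b i) =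
      (\<lambda>i. if i < Suc s then b i \<noteq> toeplitz_bit m a i 0 else b i)"
    by (auto simp: less_Suc_eq)
  have "(tm_step enc_machine ^^ (s * (2 * k + 2)))
      (4, [(int k, bit_tape k ((!) m)), (h, bit_tape r f), (int s - 1, bit_tape n ?b),
        (int (s + k), bit_tape l a)]) =
      (4, [(int k, bit_tape k ((!) m)), (h, bit_tape r f),
        (-1, bit_tape n (\<lambda>i. if i < s then ?b i \<noteq> toeplitz_bit m a i 0 else ?b i)),
        (int k, bit_tape l a)])"
    by (rule Suc.IH) (use Suc.prems in auto)
  note IH = this[unfolded eq]
  have split: "Suc s * (2 * k + 2) = s * (2 * k + 2) + (2 * k + 2)" "int (Suc s) - 1 = int s"
    by simp_all
  have "s < n" "s + k < l" using Suc.prems by auto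
  note round = enc_round_steps[OF assms(1) this]
  show ?case unfolding split funpow_add[of "s * (2 * k + 2)"] o_apply round by (rule IH)
qed simp

lemma enc_machine_computes:
  assumes "length \<rho> = 2 * n"
  shows "tm_computes_within enc_machine (2 * n * n + 6 * n + 2) [m, \<rho>] (toeplitz_enc (m, \<rho>))"
proof -
  define k where "k = length m"
  define a where "a = (\<lambda>l. \<rho> ! (2 * l))"
  define b where "b = (\<lambda>l. \<rho> ! (2 * l + 1))"
  let ?m = "bit_tape k ((!) m)" and ?\<rho> = "bit_tape (2 * n) ((!) \<rho>)"
  let ?step = "tm_step enc_machine"
  let ?out = "\<lambda>i. b i \<noteq> code_bit m a n i"
  have goal: ?thesis if "s \<le> 2 * n * n + 6 * n + 2" "(?step ^^ s) (tm_init enc_machine [m, \<rho>]) =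
      (q, [(h0, ?m), (h1, ?\<rho>), (h2, bit_tape n ?out), (h3, bit_tape n a)])"
      "enc_transition q [?m h0, ?\<rho> h1, bit_tape n ?out h2, bit_tape n a h3] = None"
    for s q h0 h1 h2 h3
  proof -
    have "tape_contents (toeplitz_enc (m, \<rho>)) = bit_tape n ?out"
      unfolding tape_contents_eq_bit_tape using assms
      by (auto simp: nth_toeplitz_enc a_def b_def intro!: bit_tape_cong)
    then show ?thesis unfolding tm_computes_within_def Let_def
      using that by (auto simp: enc_machine_def intro!: exI[of _ s])
  qed
  have "tm_init enc_machine [m, \<rho>] = (0, [(0, ?m), (0, ?\<rho>), (0, bit_tape 0 b), (0, bit_tape 0 a)])"
    using assms
    by (simp add: tm_init_def enc_machine_def eval_nat_numeral tape_contents_eq_bit_tape k_def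
        bit_tape_0)
  then have 1: "(?step ^^ (2 * n)) (tm_init enc_machine [m, \<rho>]) =
      (0, [(0, ?m), (int (2 * n), ?\<rho>), (int n, bit_tape n b), (int n, bit_tape n a)])"
    using enc_split_steps[of n n ?\<rho> "(!) \<rho>" ?m k "(!) m"] by (simp add: a_def b_def)
  have 2: "?step (0, [(0, ?m), (int (2 * n), ?\<rho>), (int n, bit_tape n b), (int n, bit_tape n a)]) =
      (2, [(0, ?m), (int (2 * n), ?\<rho>), (int n - 1, bit_tape n b), (int n, bit_tape n a)])"
    using bit_tape_blank[of "int (2 * n)" "2 * n" "(!) \<rho>"] unfolding enc_step
    by (simp add: enc_transition_def bit_tape_le not_less fun_upd_idem)
  \<comment> \<open>State 2 stops when either the message or the output is exhausted.\<close>
  define j where "j = min n k"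
  let ?b = "\<lambda>i. if n - j \<le> i then b i \<noteq> m ! (n - 1 - i) else b i"
  have 3: "(?step ^^ (j + Suc (2 * n))) (tm_init enc_machine [m, \<rho>]) =
      (2, [(int j, ?m), (int (2 * n), ?\<rho>), (int n - 1 - int j, bit_tape n ?b), (int n, bit_tape n a)])"
    unfolding funpow_add funpow.simps o_apply 1 2
    by (rule enc_message_steps) (simp_all add: j_def)
  show ?thesis
  proof (cases "k \<le> n")
    case False
    \<comment> \<open>Such long messages occur when \<epsilon> is so large that the chosen k exceeds
      n. The output head then runs off at -1 and state 2 halts; here \<open>n - k = 0\<close>, so
      every code bit is a message bit.\<close>
    then have j: "j = n" "j < k" and out: "?b = ?out"
      by (auto simp: j_def k_def code_bit_def)
    show ?thesis
    proof (rule goal[OF _ 3[unfolded out]])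
      show "enc_transition 2 [?m (int j), ?\<rho> (int (2 * n)), bit_tape n ?out (int n - 1 - int j),
          bit_tape n a (int n)] = None"
        using j bit_tape_blank[of "int n - 1 - int j" n ?out] bit_tape_nth[OF j(2), of "(!) m"]
        by (simp add: enc_transition_def bit_symbol_simps)
    qed (use j in simp)
  next
    case True
    then have j: "j = k" by (simp add: j_def)
    let ?r = "n - k"
    \<comment> \<open>The message head already stands on the blank after the message, as a round
      expects, so the first round starts without a rewind.\<close>
    have 4: "?step (2, [(int k, ?m), (int (2 * n), ?\<rho>), (int n - 1 - int k, bit_tape n ?b), (int n, bit_tape n a)])
      = (4, [(int k, ?m), (int (2 * n), ?\<rho>), (int ?r - 1, bit_tape n ?b), (int (?r + k), bit_tape n a)])"
      using bit_tape_blank[of "int k" k "(!) m"] True unfolding enc_step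
      by (simp add: enc_transition_def bit_tape_le not_less fun_upd_idem of_nat_diff)
    have 5: "(?step ^^ Suc (k + Suc (2 * n))) (tm_init enc_machine [m, \<rho>]) =
        (4, [(int k, ?m), (int (2 * n), ?\<rho>), (int ?r - 1, bit_tape n ?b), (int (?r + k), bit_tape n a)])"
      unfolding funpow.simps(2)[of "k + Suc (2 * n)"] o_apply 3[unfolded j] 4[unfolded j] j by (rule refl)
    have out: "(\<lambda>i. if i < ?r then ?b i \<noteq> toeplitz_bit m a i 0 else ?b i) = ?out"
      by (auto simp: code_bit_def k_def[symmetric] j)
    show ?thesis
    proof (rule goal)
      show "(?step ^^ (?r * (2 * k + 2) + Suc (k + Suc (2 * n)))) (tm_init enc_machine [m, \<rho>]) =
          (4, [(int k, ?m), (int (2 * n), ?\<rho>), (-1, bit_tape n ?out), (int k, bit_tape n a)])"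
        unfolding funpow_add[of "?r * (2 * k + 2)"] o_apply 5
        using enc_rounds_steps[OF k_def, of ?r n n] True unfolding out[symmetric] by simp
      show "enc_transition 4 [?m (int k), ?\<rho> (int (2 * n)), bit_tape n ?out (- 1),
          bit_tape n a (int k)] = None"
        using bit_tape_blank[of "-1" n ?out] bit_tape_blank[of "int k" k "(!) m"]
        by (simp add: enc_transition_def)
      \<comment> \<open>The rounds take at most \<open>n * (2 * n + 2)\<close> steps; the earlier
        phases take \<open>2 * n + k + 2\<close>, at most \<open>3 * n + 2\<close>.\<close>
      have "?r * (2 * k + 2) \<le> n * (2 * n + 2)" using True by (intro mult_mono) auto
      then show "?r * (2 * k + 2) + Suc (k + Suc (2 * n)) \<le> 2 * n * n + 6 * n + 2"
        using True by (simp add: algebra_simps)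
    qed
  qed
qed

section \<open>Choice of the message length\<close>

theorem theorem1p4:
  "\<exists>(T :: turing_machine) (p :: nat poly). wf_turing_machine T \<and>
     (\<forall>(n :: nat) (t :: nat) (\<epsilon> :: real). \<epsilon> > 0 \<longrightarrow>
       (\<exists>(k :: nat) (d :: nat) (Enc :: bool list \<times> bool list \<Rightarrow> bool list).
          Enc \<in> bitstrings k \<times> bitstrings d \<rightarrow> bitstrings n \<and>
          (\<forall>m\<in>bitstrings k. \<forall>\<rho>\<in>bitstrings d.
             tm_computes_within T (poly p n) [m, \<rho>] (Enc (m, \<rho>))) \<and>
          hamming_resilient t \<epsilon> (bitstrings k) (bitstrings d) (bitstrings n) Enc \<and>
          int k \<ge> int n - int t - \<lceil>log 2 (1 / \<epsilon>)\<rceil> \<and>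
          d = 2 * n))"
proof (intro exI conjI allI impI)
  show "wf_turing_machine enc_machine" by (rule wf_enc_machine)
next
  fix n t :: nat and \<epsilon> :: real
  assume pos: "\<epsilon> > 0"
  let ?e = "\<lceil>log 2 (1 / \<epsilon>)\<rceil>"
  \<comment> \<open>Truncation at 0 preserves the lower bound on k; whenever \<open>k > 0\<close>
    the difference is attained exactly.\<close>
  define k where "k = nat (int n - int t - ?e)"
  show "toeplitz_enc \<in> bitstrings k \<times> bitstrings (2 * n) \<rightarrow> bitstrings n"
    by (auto simp: bitstrings_def)
  show "\<forall>m\<in>bitstrings k. \<forall>\<rho>\<in>bitstrings (2 * n).
      tm_computes_within enc_machine (poly [:2, 6, 2:] n) [m, \<rho>] (toeplitz_enc (m, \<rho>))"
  proof (intro ballI)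
    fix m \<rho> assume "\<rho> \<in> bitstrings (2 * n)"
    then have "length \<rho> = 2 * n" by (simp add: bitstrings_def)
    from enc_machine_computes[OF this, of m]
    show "tm_computes_within enc_machine (poly [:2, 6, 2:] n) [m, \<rho>] (toeplitz_enc (m, \<rho>))"
      by (simp add: algebra_simps)
  qed
  show "int k \<ge> int n - int t - ?e" by (simp add: k_def)
  show "hamming_resilient t \<epsilon> (bitstrings k) (bitstrings (2 * n)) (bitstrings n) toeplitz_enc"
  \<comment> \<open>For \<open>\<epsilon> \<ge> 1\<close> the rounded logarithm is at most 0 and k
    may exceed n; for \<open>k = 0\<close> truncation may have occurred. Otherwise
    \<open>?e > 0\<close> forces \<open>k \<le> n\<close>.\<close>
  proof (cases "\<epsilon> \<ge> 1 \<or> k = 0")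
    case True
    moreover have "is_singleton (bitstrings 0)" by (simp add: is_singleton_altdef)
    ultimately show ?thesis using pos by (intro hamming_resilient_trivial) auto
  next
    case False
    have e: "?e > 0" using False pos by simp
    have k: "int k = int n - int t - ?e" using False by (auto simp: k_def)
    show ?thesis
    proof (rule toeplitz_enc_resilient)
      show "k \<le> n" using k e by linarith
      have "real_of_int (int (t + k)) = real_of_int (int n - ?e)" using k by simp
      \<comment> \<open>Rounding up only lowers \<open>n - ?e\<close>, so t + k is at most n plus
        the logarithm of \<epsilon>; exponentiating gives the counting bound.\<close>
      also have "\<dots> \<le> real n - log 2 (1 / \<epsilon>)" by simp
      also have "\<dots> = real n + log 2 \<epsilon>" using pos by (simp add: log_divide)
      finally have "2 powr real (t + k) \<le> 2 powr (real n + log 2 \<epsilon>)" by simp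
      also have "\<dots> = \<epsilon> * 2 ^ n" using pos by (simp add: powr_add powr_realpow)
      finally show "2 ^ (t + k) \<le> \<epsilon> * 2 ^ n" using powr_realpow[of 2 "t + k"] by simp
    qed
  qed
qed simp

end
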